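(* Let $r\in\mathbb{N}$ and suppose $\rho\in[\frac{r-1}{r},\frac{r}{r+1}]$. Then \[\tau(\rho)\le\begin{cases}\frac{(r-1)(r-2)}{r^2}+\frac{3(r-1)}{r}\left(\rho-\frac{r-1}{r}\right) & \text{if } \frac{r-1}{r}\le\rho\le\frac{r}{r+1}-\frac{1}{3r(r+1)},\\[4pt] \frac{r(r-1)}{(r+1)^2}-\frac{3(r-1)}{r+1}\left(\frac{r}{r+1}-\rho\right) & \text{if } \frac{r}{r+1}-\frac{1}{3r(r+1)}\le \rho\le\frac{r}{r+1}.\end{cases}\]
   Context: For a graph $G$ on $n$ vertices, its edge density is $\rho(G)=e(G)/\binom{n}{2}$; the triangle-degree of a vertex $x$ is the number of triangles of $G$ containing $x$, and $t_{\max}(G)$ is the maximum triangle-degree over all vertices of $G$. For $\rho\in[0,1]$, \[\tau(\rho)=\liminf_{n\to\infty}\min\left\{t_{\max}(G)/\tbinom{n-1}{2}:\ v(G)=n,\ \rho(G)\ge\rho\right\}.\] *)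

theory Defs
  imports Complex_Main "HOL-Library.Extended_Real"
begin

definition simple_graph :: "'a set \<Rightarrow> 'a set set \<Rightarrow> bool" where
  "simple_graph V E \<longleftrightarrow> finite V \<and> E \<subseteq> {e. e \<subseteq> V \<and> card e = 2}"

definition edge_density :: "'a set \<Rightarrow> 'a set set \<Rightarrow> real" where
  "edge_density V E = real (card E) / real (card V choose 2)"

definition triangles :: "'a set \<Rightarrow> 'a set set \<Rightarrow> 'a set set" where
  "triangles V E = {T. T \<subseteq> V \<and> card T = 3 \<and> (\<forall>e. e \<subseteq> T \<and> card e = 2 \<longrightarrow> e \<in> E)}"

definition triangle_degree :: "'a set \<Rightarrow> 'a set set \<Rightarrow> 'a \<Rightarrow> nat" where
  "triangle_degree V E x = card {T \<in> triangles V E. x \<in> T}"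

definition t_max :: "'a set \<Rightarrow> 'a set set \<Rightarrow> nat" where
  "t_max V E = Max (triangle_degree V E ` V)"

text \<open>
  Every finite graph is isomorphic to one whose vertices are natural numbers, so it suffices
  to let the vertex sets range over sets of naturals.
\<close>

definition t_max_ratios :: "real \<Rightarrow> nat \<Rightarrow> real set" where
  "t_max_ratios \<rho> n =
     {real (t_max V E) / real ((n - 1) choose 2) | (V :: nat set) E.
        simple_graph V E \<and> card V = n \<and> edge_density V E \<ge> \<rho>}"

text \<open>
  The lower limit is taken in the extended reals, as \<open>liminf\<close> needs a complete lattice.
  The minimum is over a finite nonempty set for all \<open>\<rho> \<le> 1\<close> and \<open>n \<ge> 2\<close>, as shown below;
  the values at smaller \<open>n\<close> do not affect the lower limit.
\<close>

definition tau :: "real \<Rightarrow> ereal" where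
  "tau \<rho> = liminf (\<lambda>n. ereal (Min (t_max_ratios \<rho> n)))"

lemma t_max_le:
  assumes "simple_graph V E" "V \<noteq> {}"
  shows "t_max V E \<le> 2 ^ card V"
proof -
  have fin: "finite V" using assms by (simp add: simple_graph_def)
  have "triangle_degree V E x \<le> 2 ^ card V" for x
  proof -
    have "{T \<in> triangles V E. x \<in> T} \<subseteq> Pow V" by (auto simp: triangles_def)
    then show ?thesis
      unfolding triangle_degree_def
      using card_mono[of "Pow V" "{T \<in> triangles V E. x \<in> T}"] fin by (simp add: card_Pow)
  qed
  then show ?thesis using fin assms(2) by (simp add: t_max_def)
qed

lemma finite_t_max_ratios:
  assumes "n \<ge> 1"
  shows "finite (t_max_ratios \<rho> n)"
proof (rule finite_subset)
  show "t_max_ratios \<rho> n \<subseteq> (\<lambda>k. real k / real ((n - 1) choose 2)) ` {..2 ^ n}"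
  proof
    fix y assume "y \<in> t_max_ratios \<rho> n"
    then obtain V :: "nat set" and E where
      VE: "y = real (t_max V E) / real ((n - 1) choose 2)" "simple_graph V E" "card V = n"
      by (auto simp: t_max_ratios_def)
    with assms have "V \<noteq> {}" by auto
    with VE t_max_le[of V E]
    show "y \<in> (\<lambda>k. real k / real ((n - 1) choose 2)) ` {..2 ^ n}" by auto
  qed
qed simp

lemma t_max_ratios_nonempty:
  assumes "\<rho> \<le> 1" "n \<ge> 2"
  shows "t_max_ratios \<rho> n \<noteq> {}"
proof -
  let ?V = "{..<n}" and ?E = "{e. e \<subseteq> {..<n} \<and> card e = 2}"
  have "card ?E = n choose 2" using n_subsets[of ?V 2] by simp
  moreover have "n choose 2 > 0" using assms(2) by simp
  ultimately have "edge_density ?V ?E = 1" by (simp add: edge_density_def)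
  then have "simple_graph ?V ?E \<and> card ?V = n \<and> edge_density ?V ?E \<ge> \<rho>"
    using assms(1) by (simp add: simple_graph_def)
  then show ?thesis unfolding t_max_ratios_def by blast
qed

end

theory Submission
  imports Defs "HOL-Real_Asymp.Real_Asymp"
begin

text \<open>Both bounds come from perturbing a balanced complete multipartite graph by regular bipartite
  graphs. Starting from \<open>r\<close> parts, a triangle-free regular graph is added inside every part; starting
  from \<open>r + 1\<close> parts, regular bipartite graphs are removed between the parts, so that all edges
  removed at a vertex lead to the same part. In either case a triangle involves at most one perturbed
  pair, so the triangle-degree is linear in the perturbation, and by symmetry it is the same at every
  vertex. Both graphs are blow-ups of a finite template whose blocks
  carry a perfect matching of partially joined pairs. As \<open>tau\<close> is a lower limit, it suffices to consider
  those \<open>n\<close> that are multiples of the number of blocks.\<close>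

section \<open>Ordered counts and transport of graphs\<close>

text \<open>The map from ordered pairs to unordered ones has fibres of size exactly two, because
  \<open>R\<close> is irreflexive. All later counts of edges and triangles go through ordered pairs,
  which turn into double sums.\<close>

lemma card_unordered_pairs:
  assumes "finite V" and sym: "\<And>x y. x \<in> V \<Longrightarrow> y \<in> V \<Longrightarrow> R x y \<Longrightarrow> R y x"
    and irr: "\<And>x. x \<in> V \<Longrightarrow> \<not> R x x"
  shows "2 * card {{x, y} | x y. x \<in> V \<and> y \<in> V \<and> R x y}
    = card {(x, y). x \<in> V \<and> y \<in> V \<and> R x y}" (is "2 * card ?E = card ?S")
proof -
  have fin: "finite ?S" by (rule finite_subset[of _ "V \<times> V"]) (use assms(1) in auto)
  have E: "?E = (\<lambda>(x, y). {x, y}) ` ?S" by auto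
  have "card ?S = (\<Sum>e\<in>?E. card {s \<in> ?S. (\<lambda>(x, y). {x, y}) s = e})"
    using sum.image_gen[OF fin, of "\<lambda>_. 1::nat" "\<lambda>(x, y). {x, y}"] unfolding E by simp
  also have "\<dots> = (\<Sum>e\<in>?E. 2)"
  proof (rule sum.cong[OF refl])
    fix e assume "e \<in> ?E"
    then obtain x y where xy: "e = {x, y}" "x \<in> V" "y \<in> V" "R x y" by auto
    then have "x \<noteq> y" using irr by auto
    have "{s \<in> ?S. (\<lambda>(x, y). {x, y}) s = e} = {(x, y), (y, x)}" (is "?L = _")
    proof (rule subset_antisym)
      show "{(x, y), (y, x)} \<subseteq> ?L" using xy(2-4) sym[OF xy(2-4)] xy(1) by (simp add: insert_commute)
      show "?L \<subseteq> {(x, y), (y, x)}" unfolding xy(1)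
        by (rule subsetI) (clarsimp simp: doubleton_eq_iff)
    qed
    then show "card {s \<in> ?S. (\<lambda>(x, y). {x, y}) s = e} = 2" using \<open>x \<noteq> y\<close> by simp
  qed
  finally show ?thesis by simp
qed

lemma card_ordered_pairs:
  assumes "finite V"
  shows "real (card {(x, y). x \<in> V \<and> y \<in> V \<and> P x y}) = (\<Sum>x\<in>V. \<Sum>y\<in>V. of_bool (P x y))"
proof -
  have "{(x, y). x \<in> V \<and> y \<in> V \<and> P x y} = Sigma V (\<lambda>x. {y \<in> V. P x y})" by auto
  then show ?thesis using assms by (simp add: card_SigmaI sum_of_bool_eq Int_def)
qed

lemma real_choose_two: "real (n choose 2) = real n * (real n - 1) / 2"
  by (induction n) (auto simp: numeral_2_eq_2 field_simps)

text \<open>Deleting \<open>x\<close> from a triangle leaves an edge inside the neighbourhood of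
  \<open>x\<close>, and this map is injective on the triangles through \<open>x\<close>. An upper
  bound suffices, since \<open>tau\<close> is only bounded from above.\<close>

lemma triangle_degree_le_ordered_pairs:
  assumes "finite V" and sym: "\<And>x y. x \<in> V \<Longrightarrow> y \<in> V \<Longrightarrow> R x y \<Longrightarrow> R y x"
    and irr: "\<And>x. x \<in> V \<Longrightarrow> \<not> R x x"
  shows "2 * triangle_degree V {{x, y} | x y. x \<in> V \<and> y \<in> V \<and> R x y} x
    \<le> card {(y, z). y \<in> V \<and> z \<in> V \<and> R x y \<and> R x z \<and> R y z}"
proof -
  let ?E = "{{x, y} | x y. x \<in> V \<and> y \<in> V \<and> R x y}"
  let ?N = "{y \<in> V. R x y}"
  let ?F = "{{y, z} | y z. y \<in> ?N \<and> z \<in> ?N \<and> R y z}"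
  have edge: "R y z" if "{y, z} \<in> ?E" for y z
    using that sym by (auto simp: doubleton_eq_iff)
  have "finite ?F" by (rule finite_subset[of _ "Pow V"]) (use assms(1) in auto)
  moreover have "inj_on (\<lambda>T. T - {x}) {T \<in> triangles V ?E. x \<in> T}"
    by (rule inj_onI) blast
  moreover have "(\<lambda>T. T - {x}) ` {T \<in> triangles V ?E. x \<in> T} \<subseteq> ?F"
  proof
    fix e assume "e \<in> (\<lambda>T. T - {x}) ` {T \<in> triangles V ?E. x \<in> T}"
    then obtain T where T: "T \<in> triangles V ?E" "x \<in> T" "e = T - {x}" by auto
    then have "card e = 2" by (simp add: triangles_def)
    then obtain y z where yz: "e = {y, z}" "y \<noteq> z" by (auto simp: card_2_iff)
    with T have eq: "T = {x, y, z}" and ne: "x \<noteq> y" "x \<noteq> z" by auto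
    have sub: "d \<subseteq> T \<Longrightarrow> card d = 2 \<Longrightarrow> d \<in> ?E" for d
      using T(1) unfolding triangles_def by blast
    have "{x, y} \<in> ?E" "{x, z} \<in> ?E" "{y, z} \<in> ?E"
      by (rule sub; use ne yz(2) eq in simp)+
    then have "R x y" "R x z" "R y z" using edge by blast+
    moreover have "y \<in> V" "z \<in> V" using T(1) eq by (auto simp: triangles_def)
    ultimately show "e \<in> ?F" using yz(1) by blast
  qed
  ultimately have "triangle_degree V ?E x \<le> card ?F"
    unfolding triangle_degree_def by (meson card_inj_on_le)
  also have "2 * card ?F = card {(y, z). y \<in> ?N \<and> z \<in> ?N \<and> R y z}"
    by (rule card_unordered_pairs) (use assms in auto)
  also have "{(y, z). y \<in> ?N \<and> z \<in> ?N \<and> R y z}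
    = {(y, z). y \<in> V \<and> z \<in> V \<and> R x y \<and> R x z \<and> R y z}" by auto
  finally show ?thesis by simp
qed

section \<open>Transport of graphs along injections\<close>

lemma triangles_image:
  assumes "inj_on f V" "simple_graph V E"
  shows "triangles (f ` V) ((`) f ` E) = (`) f ` triangles V E"
proof -
  have EV: "E \<subseteq> Pow V" using assms(2) by (auto simp: simple_graph_def)
  have mem: "f ` e \<in> (`) f ` E \<longleftrightarrow> e \<in> E" if "e \<subseteq> V" for e
    using that EV inj_on_image_eq_iff[OF assms(1)] by (auto simp: subset_iff)
  have card: "card (f ` e) = card e" if "e \<subseteq> V" for e
    by (rule card_image) (rule inj_on_subset[OF assms(1) that])
  have iff: "f ` T \<in> triangles (f ` V) ((`) f ` E) \<longleftrightarrow> T \<in> triangles V E" if T: "T \<subseteq> V" for T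
  proof -
    have "(\<forall>e. e \<subseteq> f ` T \<and> card e = 2 \<longrightarrow> e \<in> (`) f ` E)
      \<longleftrightarrow> (\<forall>e. e \<subseteq> T \<and> card (f ` e) = 2 \<longrightarrow> f ` e \<in> (`) f ` E)"
      by (auto simp: subset_image_iff)
    also have "\<dots> \<longleftrightarrow> (\<forall>e. e \<subseteq> T \<and> card e = 2 \<longrightarrow> e \<in> E)"
      using mem card T by (metis subset_trans)
    finally show ?thesis using T card by (auto simp: triangles_def)
  qed
  show ?thesis
  proof (rule set_eqI)
    fix S
    have "S \<in> triangles (f ` V) ((`) f ` E) \<longleftrightarrow> (\<exists>T. T \<subseteq> V \<and> S = f ` T \<and> f ` T \<in> triangles (f ` V) ((`) f ` E))"
      using subset_image_iff[of S f V] by (auto simp: triangles_def)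
    also have "\<dots> \<longleftrightarrow> (\<exists>T. T \<subseteq> V \<and> S = f ` T \<and> T \<in> triangles V E)"
      using iff by metis
    also have "\<dots> \<longleftrightarrow> S \<in> (`) f ` triangles V E"
      by (auto simp: triangles_def)
    finally show "S \<in> triangles (f ` V) ((`) f ` E) \<longleftrightarrow> S \<in> (`) f ` triangles V E" .
  qed
qed

text \<open>The ratios are defined with vertices in the naturals, while blow-ups have pairs as
  vertices. An injection into the naturals preserves density and triangle-degrees, so a graph over
  any type supplies a ratio.\<close>

lemma t_max_ratios_memI:
  fixes V :: "'a set"
  assumes G: "simple_graph V E" and "edge_density V E \<ge> \<rho>"
  shows "real (t_max V E) / real ((card V - 1) choose 2) \<in> t_max_ratios \<rho> (card V)"
proof -
  have fin: "finite V" using G by (simp add: simple_graph_def)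
  obtain f :: "'a \<Rightarrow> nat" where f: "inj_on f V"
    using finite_imp_inj_to_nat_seg[OF fin] by blast
  have EV: "E \<subseteq> Pow V" using G by (auto simp: simple_graph_def)
  have inj: "inj_on ((`) f) (Pow V)" using f by (rule inj_on_image_Pow)
  have card: "card (f ` e) = card e" if "e \<subseteq> V" for e
    by (rule card_image) (rule inj_on_subset[OF f that])
  have "triangle_degree (f ` V) ((`) f ` E) (f x) = triangle_degree V E x" if "x \<in> V" for x
  proof -
    have sub: "triangles V E \<subseteq> Pow V" by (auto simp: triangles_def)
    then have mem: "f x \<in> f ` T \<longleftrightarrow> x \<in> T" if "T \<in> triangles V E" for T
      using inj_on_image_mem_iff[OF f \<open>x \<in> V\<close>] that by blast
    have "{T \<in> triangles (f ` V) ((`) f ` E). f x \<in> T}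
      = (`) f ` {T \<in> triangles V E. f x \<in> f ` T}"
      unfolding triangles_image[OF f G] by blast
    also have "{T \<in> triangles V E. f x \<in> f ` T} = {T \<in> triangles V E. x \<in> T}"
      using mem by (rule Collect_cong[OF conj_cong[OF refl]])
    finally have "{T \<in> triangles (f ` V) ((`) f ` E). f x \<in> T}
      = (`) f ` {T \<in> triangles V E. x \<in> T}" .
    moreover have "inj_on ((`) f) {T \<in> triangles V E. x \<in> T}"
      by (rule inj_on_subset[OF inj]) (use sub in auto)
    ultimately show ?thesis unfolding triangle_degree_def by (simp add: card_image)
  qed
  then have "t_max (f ` V) ((`) f ` E) = t_max V E"
    unfolding t_max_def by (simp add: image_image)
  moreover have "simple_graph (f ` V) ((`) f ` E)"
    unfolding simple_graph_def
  proof (intro conjI subsetI)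
    fix d assume "d \<in> (`) f ` E"
    then obtain e where "d = f ` e" "e \<subseteq> V" "card e = 2" using G by (auto simp: simple_graph_def)
    then show "d \<in> {e. e \<subseteq> f ` V \<and> card e = 2}" using card by auto
  qed (use fin in simp)
  moreover have "card (f ` V) = card V" by (simp add: card)
  moreover have "edge_density (f ` V) ((`) f ` E) = edge_density V E"
    using card_image[OF inj_on_subset[OF inj EV]] by (simp add: edge_density_def card)
  ultimately show ?thesis
    unfolding t_max_ratios_def mem_Collect_eq using assms(2)
    by (intro exI[of _ "f ` V"] exI[of _ "(`) f ` E"]) simp
qed

text \<open>Shifting by \<open>u\<close> permutes the residues modulo \<open>m\<close>. This is what
  makes the partial bipartite graphs between partner blocks \<open>k\<close>-regular.\<close>

lemma card_add_mod_less:
  assumes "k \<le> m"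
  shows "card {v \<in> {..<m}. (u + v) mod m < k} = (k::nat)"
proof (cases "m = 0")
  case False
  have "inj_on (\<lambda>v. (u + v) mod m) {..<m}"
  proof (rule inj_onI)
    fix v w assume v: "v \<in> {..<m}" "w \<in> {..<m}" "(u + v) mod m = (u + w) mod m"
    \<comment> \<open>Adding \<open>m * u - u\<close> cancels the shift by \<open>u\<close> modulo
      \<open>m\<close> while staying in the naturals.\<close>
    then have "(u + v + (m * u - u)) mod m = (u + w + (m * u - u)) mod m"
      by (metis mod_add_left_eq)
    moreover have "u \<le> m * u" using False by (cases m) auto
    ultimately have "(v + m * u) mod m = (w + m * u) mod m" by (simp add: add.commute)
    then show "v = w" using v by simp
  qed
  moreover have "(\<lambda>v. (u + v) mod m) ` {..<m} \<subseteq> {..<m}" using False by auto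
  ultimately have bij: "bij_betw (\<lambda>v. (u + v) mod m) {..<m} {..<m}"
    by (simp add: bij_betw_def endo_inj_surj)
  have "(\<lambda>v. (u + v) mod m) ` {v \<in> {..<m}. (u + v) mod m < k}
    = (\<lambda>v. (u + v) mod m) ` {..<m} \<inter> {..<k}"
    by (rule set_eqI) (simp only: image_iff Int_iff mem_Collect_eq lessThan_iff, blast)
  also have "\<dots> = {..<m} \<inter> {..<k}" by (simp only: bij_betw_imp_surj_on[OF bij])
  also have "\<dots> = {..<k}" using assms by auto
  finally have "bij_betw (\<lambda>v. (u + v) mod m) {v \<in> {..<m}. (u + v) mod m < k} {..<k}"
    using bij_betw_imp_inj_on[OF bij] by (auto simp: bij_betw_def intro: inj_on_subset)
  then show ?thesis using bij_betw_same_card by fastforce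
qed (use assms in simp)

section \<open>Blow-ups with partially joined partner blocks\<close>

text \<open>\<open>I\<close> is the set of blocks and \<open>A\<close> tells which pairs are
  completely joined. The fixed-point-free involution \<sigma> is the perfect matching of partially
  joined blocks; on matched pairs it overrides \<open>A\<close>.\<close>

locale blowup_template =
  fixes I :: "'a set" and A :: "'a \<Rightarrow> 'a \<Rightarrow> bool" and \<sigma> :: "'a \<Rightarrow> 'a"
  assumes finite_I: "finite I" and I_nonempty: "I \<noteq> {}"
    and A_sym: "p \<in> I \<Longrightarrow> q \<in> I \<Longrightarrow> A p q \<Longrightarrow> A q p"
    and A_irrefl: "p \<in> I \<Longrightarrow> \<not> A p p"
    and partner_closed: "p \<in> I \<Longrightarrow> \<sigma> p \<in> I"
    and partner_invol: "p \<in> I \<Longrightarrow> \<sigma> (\<sigma> p) = p"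
    and partner_neq: "p \<in> I \<Longrightarrow> \<sigma> p \<noteq> p"
begin

text \<open>The edge density between two blocks of the blow-up, with \<beta> standing for
  \<open>k / m\<close>. The two sums below run over ordered tuples, so they correspond to twice the
  number of edges and twice the triangle-degree, both divided by \<open>m^2\<close>.\<close>

definition weight :: "real \<Rightarrow> 'a \<Rightarrow> 'a \<Rightarrow> real" where
  "weight \<beta> p q = (if q = \<sigma> p then \<beta> else of_bool (A p q))"

definition edge_weight :: "real \<Rightarrow> real" where
  "edge_weight \<beta> = (\<Sum>p\<in>I. \<Sum>q\<in>I. weight \<beta> p q)"

definition triangle_weight :: "real \<Rightarrow> 'a \<Rightarrow> real" where
  "triangle_weight \<beta> p = (\<Sum>q\<in>I. \<Sum>s\<in>I. weight \<beta> p q * weight \<beta> p s * weight \<beta> q s)"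

text \<open>The sum \<open>u + v\<close> (instead of a difference) makes the partial bipartite graphs between
  partner blocks symmetric, so the pair needs no orientation.\<close>

definition blowup_adj :: "nat \<Rightarrow> nat \<Rightarrow> 'a \<times> nat \<Rightarrow> 'a \<times> nat \<Rightarrow> bool" where
  "blowup_adj m k x y \<longleftrightarrow>
    (if fst y = \<sigma> (fst x) then (snd x + snd y) mod m < k else A (fst x) (fst y))"

definition blowup_verts :: "nat \<Rightarrow> ('a \<times> nat) set" where
  "blowup_verts m = I \<times> {..<m}"

definition blowup_edges :: "nat \<Rightarrow> nat \<Rightarrow> ('a \<times> nat) set set" where
  "blowup_edges m k =
    {{x, y} | x y. x \<in> blowup_verts m \<and> y \<in> blowup_verts m \<and> blowup_adj m k x y}"

lemma partner_eq_iff: "p \<in> I \<Longrightarrow> q \<in> I \<Longrightarrow> \<sigma> p = q \<longleftrightarrow> \<sigma> q = p"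
  using partner_invol by metis

lemma weight_refl: "p \<in> I \<Longrightarrow> weight \<beta> p p = 0"
  using partner_neq[of p] A_irrefl[of p] by (simp add: weight_def)

lemma finite_blowup_verts: "finite (blowup_verts m)"
  by (simp add: blowup_verts_def finite_I)

lemma card_blowup_verts: "card (blowup_verts m) = card I * m"
  by (simp add: blowup_verts_def card_cartesian_product)

lemma blowup_adj_sym:
  "x \<in> blowup_verts m \<Longrightarrow> y \<in> blowup_verts m \<Longrightarrow> blowup_adj m k x y \<Longrightarrow> blowup_adj m k y x"
  unfolding blowup_adj_def blowup_verts_def
  using partner_eq_iff[of "fst x" "fst y"] A_sym[of "fst x" "fst y"]
  by (auto simp: add.commute split: if_splits)

lemma blowup_adj_irrefl: "x \<in> blowup_verts m \<Longrightarrow> \<not> blowup_adj m k x x"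
  unfolding blowup_adj_def blowup_verts_def
  using partner_neq[of "fst x"] A_irrefl[of "fst x"] by auto

lemma simple_graph_blowup: "simple_graph (blowup_verts m) (blowup_edges m k)"
proof -
  have "card {x, y} = 2"
    if "x \<in> blowup_verts m" "y \<in> blowup_verts m" "blowup_adj m k x y" for x y
    using that blowup_adj_irrefl[of x m k] by (cases "x = y") auto
  then show ?thesis
    unfolding simple_graph_def blowup_edges_def using finite_blowup_verts by auto
qed

section \<open>Edge and triangle counts in the blow-up\<close>

lemma sum_blowup_adj:
  assumes "k \<le> m" "m > 0"
  shows "(\<Sum>v<m. of_bool (blowup_adj m k (p, u) (q, v))) = real m * weight (real k / real m) p q"
proof (cases "q = \<sigma> p")
  case True
  have "(\<Sum>v<m. of_bool (blowup_adj m k (p, u) (q, v))) = real (card {v \<in> {..<m}. (u + v) mod m < k})"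
    using True by (simp add: blowup_adj_def sum_of_bool_eq Int_def lessThan_def)
  then show ?thesis using True assms(2) card_add_mod_less[OF assms(1), of u] by (simp add: weight_def)
qed (simp add: blowup_adj_def weight_def)

lemma card_blowup_edges:
  assumes "k \<le> m" "m > 0"
  shows "2 * real (card (blowup_edges m k)) = real m ^ 2 * edge_weight (real k / real m)"
proof -
  have "2 * card (blowup_edges m k) = card {(x, y). x \<in> blowup_verts m \<and> y \<in> blowup_verts m \<and> blowup_adj m k x y}"
    unfolding blowup_edges_def
    by (rule card_unordered_pairs) (auto intro: finite_blowup_verts blowup_adj_sym dest: blowup_adj_irrefl)
  also have "real \<dots> = (\<Sum>x\<in>blowup_verts m. \<Sum>y\<in>blowup_verts m. of_bool (blowup_adj m k x y))"
    by (rule card_ordered_pairs[OF finite_blowup_verts])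
  also have "\<dots> = (\<Sum>p\<in>I. \<Sum>u<m. \<Sum>q\<in>I. \<Sum>v<m. of_bool (blowup_adj m k (p, u) (q, v)))"
    unfolding blowup_verts_def sum.cartesian_product' by simp
  also have "\<dots> = real m ^ 2 * edge_weight (real k / real m)"
    unfolding sum_blowup_adj[OF assms]
    by (simp add: edge_weight_def sum_distrib_left power2_eq_square mult.assoc)
  finally show ?thesis by simp
qed

text \<open>A partner relation is a perfect matching of the blocks, so of three pairwise adjacent blocks
  at most one pair is partial, and the three adjacency conditions are independent.\<close>

lemma sum_blowup_triangle:
  assumes "k \<le> m" "m > 0" and I: "p \<in> I" "q \<in> I" "s \<in> I"
  defines "b \<equiv> \<lambda>x y. of_bool (blowup_adj m k x y)" and "w \<equiv> weight (real k / real m)"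
  shows "(\<Sum>v<m. \<Sum>t<m. b (p, u) (q, v) * b (p, u) (s, t) * b (q, v) (s, t))
    = real m ^ 2 * (w p q * w p s * w q s)"
proof -
  have bsum: "(\<Sum>t<m. b (i, a) (j, t)) = real m * w i j" for i j a
    unfolding b_def w_def by (rule sum_blowup_adj[OF assms(1,2)])
  have const: "b (i, a) (j, c) = w i j" if "j \<noteq> \<sigma> i" for i j a c
    using that by (simp add: b_def w_def blowup_adj_def weight_def)
  have zero: "b (i, a) (i, c) = 0" "w i i = 0" if "i \<in> I" for i a c
    using const[of i i a c] weight_refl[OF that] partner_neq[OF that] by (auto simp: w_def)
  \<comment> \<open>Apart from repeated blocks, where both sides vanish, the cases leave only the
    pair \<open>p\<close>, \<open>s\<close>, then \<open>q\<close>, \<open>s\<close>, then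
    \<open>p\<close>, \<open>q\<close> possibly partial. The other two adjacencies are constant, and
    \<open>bsum\<close> evaluates the remaining one.\<close>
  consider "p = q \<or> p = s \<or> q = s" | "q \<noteq> \<sigma> p" "s \<noteq> \<sigma> q" "p \<noteq> q" "p \<noteq> s" "q \<noteq> s"
    | "q \<noteq> \<sigma> p" "s \<noteq> \<sigma> p" "p \<noteq> q" "p \<noteq> s" "q \<noteq> s"
    | "s \<noteq> \<sigma> p" "s \<noteq> \<sigma> q" "p \<noteq> q" "p \<noteq> s" "q \<noteq> s"
    using I partner_eq_iff by metis
  then show ?thesis
  proof cases
    case 1
    then show ?thesis using zero I by auto
  next
    case 2
    then show ?thesis
      by (simp add: const bsum flip: sum_distrib_left sum_distrib_right) (simp add: power2_eq_square)
  next
    case 3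
    then show ?thesis
      by (simp add: const bsum flip: sum_distrib_left sum_distrib_right) (simp add: power2_eq_square)
  next
    case 4
    then show ?thesis
      by (simp add: const bsum flip: sum_distrib_left sum_distrib_right) (simp add: power2_eq_square)
  qed
qed

lemma triangle_degree_blowup_le:
  assumes "k \<le> m" "m > 0" "p \<in> I"
  shows "2 * real (triangle_degree (blowup_verts m) (blowup_edges m k) (p, u))
    \<le> real m ^ 2 * triangle_weight (real k / real m) p"
proof -
  let ?V = "blowup_verts m" and ?R = "blowup_adj m k"
  let ?b = "\<lambda>x y. of_bool (?R x y) :: real"
  have "2 * triangle_degree ?V (blowup_edges m k) (p, u)
    \<le> card {(y, z). y \<in> ?V \<and> z \<in> ?V \<and> ?R (p, u) y \<and> ?R (p, u) z \<and> ?R y z}"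
    unfolding blowup_edges_def
    by (rule triangle_degree_le_ordered_pairs) (auto intro: finite_blowup_verts blowup_adj_sym dest: blowup_adj_irrefl)
  then have "2 * real (triangle_degree ?V (blowup_edges m k) (p, u))
    \<le> real (card {(y, z). y \<in> ?V \<and> z \<in> ?V \<and> ?R (p, u) y \<and> ?R (p, u) z \<and> ?R y z})"
    by linarith
  also have "\<dots> = (\<Sum>y\<in>?V. \<Sum>z\<in>?V. of_bool (?R (p, u) y \<and> ?R (p, u) z \<and> ?R y z))"
    by (rule card_ordered_pairs[OF finite_blowup_verts])
  also have "\<dots> = (\<Sum>y\<in>?V. \<Sum>z\<in>?V. ?b (p, u) y * ?b (p, u) z * ?b y z)"
    by (simp add: of_bool_conj mult.assoc)
  also have "\<dots> = (\<Sum>q\<in>I. \<Sum>v<m. \<Sum>s\<in>I. \<Sum>t<m. ?b (p, u) (q, v) * ?b (p, u) (s, t) * ?b (q, v) (s, t))"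
    unfolding blowup_verts_def sum.cartesian_product' by simp
  also have "\<dots> = (\<Sum>q\<in>I. \<Sum>s\<in>I. \<Sum>v<m. \<Sum>t<m. ?b (p, u) (q, v) * ?b (p, u) (s, t) * ?b (q, v) (s, t))"
    by (intro sum.cong refl sum.swap)
  also have "\<dots> = real m ^ 2 * triangle_weight (real k / real m) p"
    unfolding triangle_weight_def sum_distrib_left
    by (intro sum.cong refl sum_blowup_triangle assms)
  finally show ?thesis .
qed

section \<open>From block weights to a bound on \<open>tau\<close>\<close>

lemma edge_weight_mono:
  assumes "\<beta> \<le> \<beta>'"
  shows "edge_weight \<beta> \<le> edge_weight \<beta>'"
  unfolding edge_weight_def weight_def by (intro sum_mono) (use assms in auto)

lemma tendsto_triangle_weight:
  assumes "(b \<longlongrightarrow> \<beta>) F"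
  shows "((\<lambda>x. triangle_weight (b x) p) \<longlongrightarrow> triangle_weight \<beta> p) F"
proof -
  have "((\<lambda>x. weight (b x) q s) \<longlongrightarrow> weight \<beta> q s) F" for q s
    unfolding weight_def using assms by simp
  then show ?thesis unfolding triangle_weight_def by (intro tendsto_intros)
qed

lemma card_I_ge_2: "card I \<ge> 2"
proof -
  obtain p where p: "p \<in> I" using I_nonempty by auto
  have "card {p, \<sigma> p} \<le> card I"
    by (rule card_mono) (use finite_I p partner_closed in auto)
  then show ?thesis using partner_neq[OF p] by auto
qed

lemma t_max_blowup_le:
  assumes "k \<le> m" "m > 0" and T: "\<And>p. p \<in> I \<Longrightarrow> triangle_weight (real k / real m) p \<le> T"
  shows "2 * real (t_max (blowup_verts m) (blowup_edges m k)) \<le> real m ^ 2 * T"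
proof -
  let ?D = "triangle_degree (blowup_verts m) (blowup_edges m k)"
  have "blowup_verts m \<noteq> {}" using I_nonempty assms(2) by (auto simp: blowup_verts_def)
  then have "t_max (blowup_verts m) (blowup_edges m k) \<in> ?D ` blowup_verts m"
    unfolding t_max_def by (intro Max_in) (auto simp: finite_blowup_verts)
  then obtain p u where p: "p \<in> I" "t_max (blowup_verts m) (blowup_edges m k) = ?D (p, u)"
    by (auto simp: blowup_verts_def)
  then have "2 * real (t_max (blowup_verts m) (blowup_edges m k))
    \<le> real m ^ 2 * triangle_weight (real k / real m) p"
    using triangle_degree_blowup_le[OF assms(1,2)] by simp
  also have "\<dots> \<le> real m ^ 2 * T" by (intro mult_left_mono T p) simp
  finally show ?thesis .
qed

text \<open>The hypothesis says that twice the number of edges is at least \<rho> times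
  \<open>n^2\<close>, where \<open>n\<close> is the number of vertices. This exceeds what density
  \<rho> requires, namely \<rho> times \<open>n * (n - 1)\<close>, so the density bound holds for
  every \<open>m > 0\<close> and not just asymptotically.\<close>

lemma edge_density_blowup_ge:
  assumes "k \<le> m" "m > 0" "\<rho> \<ge> 0" and "\<rho> * real (card I) ^ 2 \<le> edge_weight (real k / real m)"
  shows "\<rho> \<le> edge_density (blowup_verts m) (blowup_edges m k)"
proof -
  define n where "n = card I * m"
  have "n \<ge> 2" using card_I_ge_2 assms(2) unfolding n_def
    by (metis One_nat_def Suc_leI mult_le_mono nat_mult_1_right)
  have choose: "real (n choose 2) = real n * (real n - 1) / 2"
    using \<open>n \<ge> 2\<close> by (simp add: real_choose_two)
  then have pos: "real (n choose 2) > 0" using \<open>n \<ge> 2\<close> by simp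
  have "\<rho> * (real n * (real n - 1)) \<le> \<rho> * (real n * real n)"
    using assms(3) by (intro mult_left_mono) auto
  also have "\<dots> = real m ^ 2 * (\<rho> * real (card I) ^ 2)" by (simp add: n_def power2_eq_square)
  also have "\<dots> \<le> real m ^ 2 * edge_weight (real k / real m)"
    by (intro mult_left_mono assms) simp
  finally have "\<rho> * real (n choose 2) \<le> real (card (blowup_edges m k))"
    using card_blowup_edges[OF assms(1,2)] unfolding choose by simp
  then show ?thesis
    using pos unfolding edge_density_def card_blowup_verts n_def by (simp add: pos_le_divide_eq)
qed

text \<open>Approximating \<beta> from above by fractions \<open>k / m\<close> keeps enough edges by
  monotonicity, while the triangle weights converge because they are polynomial in \<beta>. The
  rounding error is absorbed by \<epsilon>.\<close>

lemma tau_le_triangle_weight: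
  assumes \<beta>: "0 \<le> \<beta>" "\<beta> \<le> 1" and \<rho>: "0 \<le> \<rho>" "\<rho> * real (card I) ^ 2 \<le> edge_weight \<beta>"
    and T: "\<And>p. p \<in> I \<Longrightarrow> triangle_weight \<beta> p \<le> T * real (card I) ^ 2"
  shows "tau \<rho> \<le> ereal T"
proof (rule ereal_le_epsilon2)
  fix \<epsilon> :: real assume "\<epsilon> > 0"
  define N where "N = card I"
  define k where "k m = nat \<lceil>\<beta> * real m\<rceil>" for m :: nat
  define b where "b m = real (k m) / real m" for m
  \<comment> \<open>Bound on the ratio for \<open>n = N * m\<close> vertices; the quotient replaces
    \<open>(n - 1) choose 2\<close> by \<open>n^2 / 2\<close> and tends to 1.\<close>
  define Y where "Y m = (T + \<epsilon>) * (real (N * m) ^ 2 / ((real (N * m) - 1) * (real (N * m) - 2)))" for m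
  have N: "N \<ge> 2" unfolding N_def by (rule card_I_ge_2)
  have k_le: "k m \<le> m" for m
  proof -
    have "\<beta> * real m \<le> real m" using \<beta> by (simp add: mult_left_le_one_le)
    then show ?thesis by (simp add: k_def ceiling_le_iff)
  qed
  have rk: "real (k m) = of_int \<lceil>\<beta> * real m\<rceil>" for m
    using \<beta> by (simp add: k_def)
  have b_ge: "\<beta> \<le> b m" if "m > 0" for m
    unfolding b_def rk using that by (simp add: field_simps)
  have b_le: "b m \<le> \<beta> + 1 / real m" if "m > 0" for m
  proof -
    have "real_of_int \<lceil>\<beta> * real m\<rceil> \<le> \<beta> * real m + 1" by linarith
    then show ?thesis unfolding b_def rk using that by (simp add: field_simps)
  qed
  have "b \<longlonglongrightarrow> \<beta>"
  proof (rule tendsto_sandwich)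
    show "\<forall>\<^sub>F m in sequentially. \<beta> \<le> b m" "\<forall>\<^sub>F m in sequentially. b m \<le> \<beta> + 1 / real m"
      using b_ge b_le by (auto intro: eventually_sequentiallyI[of 1])
    show "(\<lambda>m. \<beta> + 1 / real m) \<longlonglongrightarrow> \<beta>"
      using tendsto_add[OF tendsto_const lim_1_over_n, of \<beta>] by simp
  qed auto
  moreover have "triangle_weight \<beta> p < (T + \<epsilon>) * real N ^ 2" if "p \<in> I" for p
  proof -
    have "T * real N ^ 2 < (T + \<epsilon>) * real N ^ 2" using \<open>\<epsilon> > 0\<close> N by simp
    then show ?thesis using T[OF that] unfolding N_def by linarith
  qed
  ultimately have tw: "\<forall>\<^sub>F m in sequentially. \<forall>p\<in>I. triangle_weight (b m) p < (T + \<epsilon>) * real N ^ 2"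
    by (intro eventually_ball_finite finite_I ballI order_tendstoD(2)[OF tendsto_triangle_weight])
  have le: "Min (t_max_ratios \<rho> (N * m)) \<le> Y m"
    if m: "m \<ge> 2" and tw: "\<forall>p\<in>I. triangle_weight (b m) p < (T + \<epsilon>) * real N ^ 2" for m
  proof -
    let ?V = "blowup_verts m" and ?E = "blowup_edges m (k m)"
    define n where "n = N * m"
    have n4: "n \<ge> 4" using mult_le_mono[OF N m] by (simp add: n_def)
    have "edge_weight \<beta> \<le> edge_weight (b m)" using m by (intro edge_weight_mono b_ge) simp
    then have "\<rho> \<le> edge_density ?V ?E"
      using m \<rho> by (intro edge_density_blowup_ge k_le) (auto simp: b_def)
    then have "real (t_max ?V ?E) / real ((n - 1) choose 2) \<in> t_max_ratios \<rho> n"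
      using t_max_ratios_memI[OF simple_graph_blowup, of \<rho> m "k m"]
      by (simp add: card_blowup_verts n_def N_def)
    then have "Min (t_max_ratios \<rho> n) \<le> real (t_max ?V ?E) / real ((n - 1) choose 2)"
      using n4 by (intro Min_le finite_t_max_ratios) auto
    also have "\<dots> = 2 * real (t_max ?V ?E) / ((real n - 1) * (real n - 2))"
      using n4 by (simp add: real_choose_two of_nat_diff field_simps)
    also have "\<dots> \<le> (real m ^ 2 * ((T + \<epsilon>) * real N ^ 2)) / ((real n - 1) * (real n - 2))"
    proof (rule divide_right_mono)
      show "2 * real (t_max ?V ?E) \<le> real m ^ 2 * ((T + \<epsilon>) * real N ^ 2)"
        using tw m by (intro t_max_blowup_le k_le) (auto simp: b_def intro: less_imp_le)
      show "0 \<le> (real n - 1) * (real n - 2)" using n4 by simp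
    qed
    also have "\<dots> = Y m" by (simp add: Y_def n_def power_mult_distrib mult_ac)
    finally show ?thesis by (simp add: n_def)
  qed
  \<comment> \<open>Restricting to multiples of \<open>N\<close> can only increase the lower
    limit.\<close>
  have "tau \<rho> \<le> liminf ((\<lambda>n. ereal (Min (t_max_ratios \<rho> n))) \<circ> (\<lambda>m. N * m))"
    unfolding tau_def by (rule liminf_subseq_mono) (use N in \<open>auto simp: strict_mono_def\<close>)
  also have "\<dots> \<le> liminf (\<lambda>m. ereal (Y m))"
  proof (rule Liminf_mono)
    show "\<forall>\<^sub>F m in sequentially. ((\<lambda>n. ereal (Min (t_max_ratios \<rho> n))) \<circ> (\<lambda>m. N * m)) m \<le> ereal (Y m)"
      using tw eventually_ge_at_top[of 2] by eventually_elim (use le in simp)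
  qed
  also have "\<dots> = ereal (T + \<epsilon>)"
  proof (rule lim_imp_Liminf)
    have "(\<lambda>n. real n ^ 2 / ((real n - 1) * (real n - 2))) \<longlonglongrightarrow> 1"
      by real_asymp
    then have "(\<lambda>m. real (N * m) ^ 2 / ((real (N * m) - 1) * (real (N * m) - 2))) \<longlonglongrightarrow> 1"
      by (rule filterlim_compose) (use N in \<open>auto intro!: filterlim_subseq simp: strict_mono_def\<close>)
    then have "Y \<longlonglongrightarrow> (T + \<epsilon>) * 1" unfolding Y_def by (intro tendsto_intros)
    then show "(\<lambda>m. ereal (Y m)) \<longlonglongrightarrow> ereal (T + \<epsilon>)" by simp
  qed simp
  finally show "tau \<rho> \<le> ereal T + ereal \<epsilon>" by simp
qed

end

section \<open>Perturbed complete multipartite graphs\<close>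

lemma sum_of_bool_neq:
  assumes "i < n"
  shows "(\<Sum>k<n. of_bool (i \<noteq> k)) = real n - 1"
proof -
  have "(\<Sum>k<n. of_bool (i \<noteq> k)) = (\<Sum>k<n. 1 - (if i = k then 1 else 0 :: real))"
    by (rule sum.cong) auto
  then show ?thesis using assms by (simp add: sum_subtractf)
qed

lemma sum_of_bool_neq_neq:
  assumes "i < n" "j < n" "i \<noteq> j"
  shows "(\<Sum>k<n. of_bool (i \<noteq> k) * of_bool (j \<noteq> k)) = real n - 2"
proof -
  have "(\<Sum>k<n. of_bool (i \<noteq> k) * of_bool (j \<noteq> k))
    = (\<Sum>k<n. 1 - (if i = k then 1 else 0) - (if j = k then 1 else 0 :: real))"
    using assms(3) by (intro sum.cong) auto
  then show ?thesis using assms by (simp add: sum_subtractf)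
qed

text \<open>Common frame of both constructions: a block \<open>(i, l)\<close> is cell
  \<open>l\<close> of part \<open>i\<close>, every part has \<open>g\<close> cells, and cells of
  different parts are completely joined before the perturbation.\<close>

locale multipartite_template =
  blowup_template "Sigma {..<R} L" "\<lambda>p q. fst p \<noteq> fst q" \<sigma>
  for R :: nat and L :: "nat \<Rightarrow> nat set" and \<sigma> :: "nat \<times> nat \<Rightarrow> nat \<times> nat" +
  fixes g :: nat
  assumes card_L: "i < R \<Longrightarrow> card (L i) = g" and g_pos: "g > 0"
begin

abbreviation "blocks \<equiv> Sigma {..<R} L"

text \<open>With \<open>cross\<close> and \<open>matched\<close>, both constructions have weight
  \<open>cross + c * matched\<close>: \<open>c\<close> is \<beta> when edges are added inside parts,
  and \<beta> - 1 when they are removed between parts.\<close>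

definition cross :: "nat \<times> nat \<Rightarrow> nat \<times> nat \<Rightarrow> real" where
  "cross p q = of_bool (fst p \<noteq> fst q)"

definition matched :: "nat \<times> nat \<Rightarrow> nat \<times> nat \<Rightarrow> real" where
  "matched p q = of_bool (q = \<sigma> p)"

lemma finite_L: "i < R \<Longrightarrow> finite (L i)"
  using card_L[of i] g_pos by (metis card.infinite less_irrefl)

lemma sum_blocks: "(\<Sum>q\<in>blocks. f q) = (\<Sum>k<R. \<Sum>l\<in>L k. f (k, l))" for f :: "nat \<times> nat \<Rightarrow> real"
  using finite_L by (subst sum.Sigma) auto

lemma sum_blocks_fst: "(\<Sum>q\<in>blocks. f (fst q)) = real g * (\<Sum>k<R. f k)" for f :: "nat \<Rightarrow> real"
  unfolding sum_blocks by (simp add: card_L sum_distrib_left)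

lemma card_blocks: "real (card blocks) = real g * real R"
  using sum_blocks_fst[of "\<lambda>_. 1"] by simp

lemma sum_cross:
  assumes "p \<in> blocks"
  shows "(\<Sum>q\<in>blocks. cross p q) = real g * (real R - 1)"
  using assms sum_blocks_fst[of "\<lambda>k. of_bool (fst p \<noteq> k)"] sum_of_bool_neq[of "fst p" R]
  by (auto simp: cross_def)

lemma sum_cross_cross:
  assumes "p \<in> blocks" "q \<in> blocks" "fst p \<noteq> fst q"
  shows "(\<Sum>s\<in>blocks. cross p s * cross q s) = real g * (real R - 2)"
  using assms sum_blocks_fst[of "\<lambda>k. of_bool (fst p \<noteq> k) * of_bool (fst q \<noteq> k)"]
    sum_of_bool_neq_neq[of "fst p" R "fst q"]
  by (auto simp: cross_def)

lemma sum_matched: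
  assumes "p \<in> blocks"
  shows "(\<Sum>q\<in>blocks. matched p q * f q) = f (\<sigma> p)"
proof -
  have "(\<Sum>q\<in>blocks. matched p q * f q) = (\<Sum>q\<in>blocks. if q = \<sigma> p then f q else 0)"
    by (rule sum.cong) (auto simp: matched_def)
  then show ?thesis using partner_closed[OF assms] finite_I by simp
qed

text \<open>No triple of blocks can contain two matched pairs and be adjacent in the third pair, so a
  product of three perturbed adjacencies is linear in the perturbation.\<close>

lemma perturbed_product:
  assumes I: "p \<in> blocks" "q \<in> blocks" "s \<in> blocks"
  shows "(cross p q + c * matched p q) * (cross p s + c * matched p s) * (cross q s + c * matched q s)
    = cross p q * (cross p s * cross q s)
      + c * (matched p q * (cross p s * cross q s) + matched p s * (cross p q * cross s q)
        + cross p q * (matched q s * cross p s))"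
proof -
  have sym: "cross s q = cross q s" by (auto simp: cross_def)
  have 1: "matched p q * matched p s * cross q s = 0"
    by (auto simp: matched_def cross_def)
  have 2: "matched p q * matched q s * cross p s = 0"
    using partner_invol[OF I(1)] by (auto simp: matched_def cross_def)
  have "p = q" if "s = \<sigma> p" "s = \<sigma> q"
    using that partner_invol[OF I(1)] partner_invol[OF I(2)] by metis
  then have 3: "matched p s * matched q s * cross p q = 0"
    by (cases "s = \<sigma> p \<and> s = \<sigma> q") (auto simp: matched_def cross_def)
  have 4: "matched p q * matched p s * matched q s = 0"
    using partner_neq[OF I(2)] by (auto simp: matched_def)
  \<comment> \<open>Expansion in powers of \<open>c\<close>; the facts above kill the quadratic and
    cubic coefficients.\<close>
  have "(cross p q + c * matched p q) * (cross p s + c * matched p s) * (cross q s + c * matched q s)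
    = cross p q * (cross p s * cross q s)
      + c * (matched p q * (cross p s * cross q s) + matched p s * (cross p q * cross q s)
        + cross p q * (matched q s * cross p s))
      + c\<^sup>2 * (matched p q * matched p s * cross q s + matched p q * matched q s * cross p s
        + matched p s * matched q s * cross p q)
      + c ^ 3 * (matched p q * matched p s * matched q s)"
    by (simp add: algebra_simps power2_eq_square power3_eq_cube)
  then show ?thesis unfolding 1 2 3 4 sym by simp
qed

lemma edge_weight_perturbed:
  assumes "\<And>p q. p \<in> blocks \<Longrightarrow> q \<in> blocks \<Longrightarrow> weight \<beta> p q = cross p q + c * matched p q"
  shows "edge_weight \<beta> = real (card blocks) * (real g * (real R - 1) + c)"
proof -
  have "edge_weight \<beta> = (\<Sum>p\<in>blocks. (\<Sum>q\<in>blocks. cross p q) + c * (\<Sum>q\<in>blocks. matched p q * 1))"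
    unfolding edge_weight_def by (simp add: assms sum.distrib sum_distrib_left)
  also have "\<dots> = (\<Sum>p\<in>blocks. real g * (real R - 1) + c)"
  proof (rule sum.cong[OF refl])
    fix p assume p: "p \<in> blocks"
    show "(\<Sum>q\<in>blocks. cross p q) + c * (\<Sum>q\<in>blocks. matched p q * 1) = real g * (real R - 1) + c"
      unfolding sum_cross[OF p] sum_matched[OF p] by simp
  qed
  finally show ?thesis by simp
qed

text \<open>The linear term has one sum for each position of the matched pair in a triangle of
  blocks. The two positions containing \<open>p\<close> contribute equally, hence the factor 2; the
  last sum is for the pair opposite \<open>p\<close>.\<close>

lemma triangle_weight_perturbed:
  assumes w: "\<And>p q. p \<in> blocks \<Longrightarrow> q \<in> blocks \<Longrightarrow> weight \<beta> p q = cross p q + c * matched p q"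
    and p: "p \<in> blocks"
  shows "triangle_weight \<beta> p = real g ^ 2 * (real R - 1) * (real R - 2)
    + c * (2 * (\<Sum>s\<in>blocks. cross p s * cross (\<sigma> p) s) + (\<Sum>q\<in>blocks. cross p q * cross p (\<sigma> q)))"
proof -
  have "triangle_weight \<beta> p
    = (\<Sum>q\<in>blocks. \<Sum>s\<in>blocks. cross p q * (cross p s * cross q s)
      + c * (matched p q * (cross p s * cross q s) + matched p s * (cross p q * cross s q)
        + cross p q * (matched q s * cross p s)))"
    unfolding triangle_weight_def using w p perturbed_product by (intro sum.cong refl) simp
  also have "\<dots> = (\<Sum>q\<in>blocks. cross p q * (\<Sum>s\<in>blocks. cross p s * cross q s))
      + c * ((\<Sum>q\<in>blocks. matched p q * (\<Sum>s\<in>blocks. cross p s * cross q s))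
        + (\<Sum>q\<in>blocks. \<Sum>s\<in>blocks. matched p s * (cross p q * cross s q))
        + (\<Sum>q\<in>blocks. cross p q * (\<Sum>s\<in>blocks. matched q s * cross p s)))"
    by (simp only: sum.distrib sum_distrib_left distrib_left)
  also have "(\<Sum>q\<in>blocks. cross p q * (\<Sum>s\<in>blocks. cross p s * cross q s))
      = (\<Sum>q\<in>blocks. cross p q * (real g * (real R - 2)))"
  proof (rule sum.cong[OF refl])
    fix q assume "q \<in> blocks"
    then show "cross p q * (\<Sum>s\<in>blocks. cross p s * cross q s) = cross p q * (real g * (real R - 2))"
      using sum_cross_cross[OF p, of q] by (cases "fst p = fst q") (auto simp: cross_def)
  qed
  also have "\<dots> = real g ^ 2 * (real R - 1) * (real R - 2)"
    using sum_cross[OF p] by (simp add: power2_eq_square flip: sum_distrib_right)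
  also have "(\<Sum>q\<in>blocks. matched p q * (\<Sum>s\<in>blocks. cross p s * cross q s))
      = (\<Sum>s\<in>blocks. cross p s * cross (\<sigma> p) s)"
    by (rule sum_matched[OF p])
  also have "(\<Sum>q\<in>blocks. \<Sum>s\<in>blocks. matched p s * (cross p q * cross s q))
      = (\<Sum>s\<in>blocks. cross p s * cross (\<sigma> p) s)"
    by (simp only: sum_matched[OF p])
  also have "(\<Sum>q\<in>blocks. cross p q * (\<Sum>s\<in>blocks. matched q s * cross p s))
      = (\<Sum>q\<in>blocks. cross p q * cross p (\<sigma> q))"
    by (intro sum.cong refl) (simp only: sum_matched)
  finally show ?thesis by simp
qed

end

text \<open>Balanced complete \<open>r\<close>-partite graph with a regular bipartite graph added inside each part,
  of density chosen to produce the excess \<open>\<rho> - (r - 1) / r\<close>.\<close>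

lemma tau_le_add_bipartite:
  fixes r :: nat and \<rho> :: real
  assumes r: "r \<ge> 1" and \<rho>: "(real r - 1) / real r \<le> \<rho>" "\<rho> \<le> (real r - 1) / real r + 1 / (2 * real r)"
  shows "tau \<rho> \<le> ereal ((real r - 1) * (real r - 2) / (real r)\<^sup>2
    + 3 * (real r - 1) / real r * (\<rho> - (real r - 1) / real r))"
proof -
  \<comment> \<open>Each part consists of two halves, and \<sigma> swaps them.\<close>
  define \<sigma> :: "nat \<times> nat \<Rightarrow> nat \<times> nat" where "\<sigma> = (\<lambda>(i, a). (i, 1 - a))"
  interpret multipartite_template r "\<lambda>_. {..<2}" \<sigma> 2
  proof
    show "Sigma {..<r} (\<lambda>_. {..<2::nat}) \<noteq> {}" using r by (auto simp: lessThan_empty_iff)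
  qed (auto simp: \<sigma>_def less_2_cases_iff)
  \<comment> \<open>A half is a fraction \<open>1 / (2 * r)\<close> of all vertices, so joining the
    halves with density \<beta> raises the edge density by \<open>\<beta> / (2 * r)\<close> in the
    limit. The upper bound on \<rho> is exactly \<beta> \<le> 1.\<close>
  define \<beta> where "\<beta> = 2 * real r * (\<rho> - (real r - 1) / real r)"
  have "2 * real r * (\<rho> - (real r - 1) / real r) \<le> 2 * real r * (1 / (2 * real r))"
    using \<rho>(2) by (intro mult_left_mono) auto
  then have \<beta>01: "0 \<le> \<beta>" "\<beta> \<le> 1" using r \<rho>(1) by (simp_all add: \<beta>_def)
  have fst_\<sigma>: "fst (\<sigma> p) = fst p" for p by (simp add: \<sigma>_def split_beta)
  have w: "weight \<beta> p q = cross p q + \<beta> * matched p q" for p q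
    by (auto simp: weight_def cross_def matched_def fst_\<sigma>)
  have "0 \<le> (real r - 1) / real r" using r by simp
  with \<rho> have \<rho>0: "0 \<le> \<rho>" by linarith
  show ?thesis
  proof (rule tau_le_triangle_weight[OF \<beta>01 \<rho>0])
    have "edge_weight \<beta> = real (card blocks) * (2 * (real r - 1) + \<beta>)"
      by (subst edge_weight_perturbed[OF w]) simp_all
    also have "\<dots> = \<rho> * real (card blocks) ^ 2"
      unfolding card_blocks \<beta>_def using r by (simp add: field_simps power2_eq_square)
    finally show "\<rho> * real (card blocks) ^ 2 \<le> edge_weight \<beta>" by simp
    fix p assume p: "p \<in> blocks"
    have sq: "cross p s * cross p s = cross p s" for s by (simp add: cross_def)
    have c: "cross (\<sigma> p) s = cross p s" "cross p (\<sigma> s) = cross p s" for s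
      by (simp_all add: cross_def fst_\<sigma>)
    \<comment> \<open>As \<sigma> preserves parts, all three correction sums reduce to the number
      \<open>2 * (r - 1)\<close> of blocks outside the part of \<open>p\<close>.\<close>
    have "triangle_weight \<beta> p = 4 * (real r - 1) * (real r - 2) + 6 * \<beta> * (real r - 1)"
      by (subst triangle_weight_perturbed[OF w p])
        (simp_all only: c sq sum_cross[OF p], simp add: algebra_simps)
    also have "\<dots> = ((real r - 1) * (real r - 2) / (real r)\<^sup>2
      + 3 * (real r - 1) / real r * (\<rho> - (real r - 1) / real r)) * real (card blocks) ^ 2"
      unfolding card_blocks \<beta>_def using r by (simp add: field_simps power2_eq_square)
    finally show "triangle_weight \<beta> p \<le> ((real r - 1) * (real r - 2) / (real r)\<^sup>2
      + 3 * (real r - 1) / real r * (\<rho> - (real r - 1) / real r)) * real (card blocks) ^ 2" by simp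
  qed
qed

text \<open>Balanced complete \<open>(r + 1)\<close>-partite graph, each part \<open>i\<close> split into cells \<open>(i, j)\<close>, one for every
  other part \<open>j\<close>, with a regular bipartite graph removed between the cells \<open>(i, j)\<close> and \<open>(j, i)\<close>.\<close>

lemma tau_le_remove_bipartite:
  fixes r :: nat and \<rho> :: real
  assumes r: "r \<ge> 1" and \<rho>: "real r / (real r + 1) - 1 / (real r * (real r + 1)) \<le> \<rho>" "\<rho> \<le> real r / (real r + 1)"
    and \<rho>0: "0 \<le> \<rho>"
  shows "tau \<rho> \<le> ereal (real r * (real r - 1) / (real r + 1)\<^sup>2
    - 3 * (real r - 1) / (real r + 1) * (real r / (real r + 1) - \<rho>))"
proof -
  define \<sigma> :: "nat \<times> nat \<Rightarrow> nat \<times> nat" where "\<sigma> = (\<lambda>(i, j). (j, i))"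
  interpret multipartite_template "r + 1" "\<lambda>i. {..<r + 1} - {i}" \<sigma> r
  proof
    have "(0, 1) \<in> Sigma {..<r + 1} (\<lambda>i. {..<r + 1} - {i})" using r by simp
    then show "Sigma {..<r + 1} (\<lambda>i. {..<r + 1} - {i}) \<noteq> {}" by blast
  qed (use r in \<open>auto simp: \<sigma>_def\<close>)
  have r1: "real r + 1 \<noteq> 0" by linarith
  \<comment> \<open>A cell is a fraction \<open>1 / (r * (r + 1))\<close> of all vertices, so
    removing density \<open>-c\<close> between matched cells lowers the edge density by
    \<open>-c / (r * (r + 1))\<close> in the limit. The lower bound on \<rho> says that matched
    cells lose at most all their edges.\<close>
  define c where "c = - (real r * (real r + 1) * (real r / (real r + 1) - \<rho>))"
  have "real r / (real r + 1) - \<rho> \<le> 1 / (real r * (real r + 1))" using \<rho> by linarith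
  then have "(real r / (real r + 1) - \<rho>) * (real r * (real r + 1)) \<le> 1"
    using r by (subst (asm) pos_le_divide_eq) auto
  moreover have "0 \<le> (real r / (real r + 1) - \<rho>) * (real r * (real r + 1))"
    using \<rho> by simp
  ultimately have \<beta>01: "0 \<le> 1 + c" "1 + c \<le> 1" unfolding c_def by (simp_all only: mult.commute)
  have fst_\<sigma>: "fst (\<sigma> p) \<noteq> fst p" if "p \<in> blocks" for p using that by (auto simp: \<sigma>_def)
  have w: "weight (1 + c) p q = cross p q + c * matched p q" if "p \<in> blocks" "q \<in> blocks" for p q
    using fst_\<sigma>[OF that(1)] by (auto simp: weight_def cross_def matched_def)
  show ?thesis
  proof (rule tau_le_triangle_weight[OF \<beta>01 \<rho>0])
    have "edge_weight (1 + c) = real (card blocks) * (real r ^ 2 + c)"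
      by (subst edge_weight_perturbed[OF w]) (simp_all add: power2_eq_square)
    also have "real r ^ 2 + c = \<rho> * (real r * (real r + 1))"
      using r1 by (simp add: c_def field_simps power2_eq_square)
    also have "real (card blocks) * \<dots> = \<rho> * real (card blocks) ^ 2"
      unfolding card_blocks by (simp add: field_simps power2_eq_square)
    finally show "\<rho> * real (card blocks) ^ 2 \<le> edge_weight (1 + c)" by simp
    fix p assume p: "p \<in> blocks"
    \<comment> \<open>For \<open>q = (k, l)\<close> the partner lies in part \<open>l\<close>, so
      this counts ordered pairs of distinct parts \<open>k\<close>, \<open>l\<close>, both different
      from the part of \<open>p\<close>.\<close>
    have "(\<Sum>q\<in>blocks. cross p q * cross p (\<sigma> q))
      = (\<Sum>k<r + 1. of_bool (fst p \<noteq> k) * (\<Sum>l\<in>{..<r + 1} - {k}. of_bool (fst p \<noteq> l)))"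
      unfolding sum_blocks by (simp only: cross_def \<sigma>_def fst_conv prod.case sum_distrib_left)
    also have "\<dots> = (\<Sum>k<r + 1. of_bool (fst p \<noteq> k) * (real r - 1))"
    proof (rule sum.cong[OF refl])
      fix k assume k: "k \<in> {..<r + 1}"
      have "(\<Sum>l\<in>{..<r + 1} - {k}. of_bool (fst p \<noteq> l)) = real r - of_bool (fst p \<noteq> k)"
        using sum_of_bool_neq[of "fst p" "r + 1"] k p by (subst sum_diff1) auto
      then show "of_bool (fst p \<noteq> k) * (\<Sum>l\<in>{..<r + 1} - {k}. of_bool (fst p \<noteq> l))
        = of_bool (fst p \<noteq> k) * (real r - 1)" by simp
    qed
    also have "\<dots> = real r * (real r - 1)"
      using sum_of_bool_neq[of "fst p" "r + 1"] p by (subst sum_distrib_right[symmetric]) auto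
    finally have 1: "(\<Sum>q\<in>blocks. cross p q * cross p (\<sigma> q)) = real r * (real r - 1)" .
    have 2: "(\<Sum>s\<in>blocks. cross p s * cross (\<sigma> p) s) = real r * (real r - 1)"
      using sum_cross_cross[OF p partner_closed[OF p]] fst_\<sigma>[OF p] by simp
    have "triangle_weight (1 + c) p = real r ^ 3 * (real r - 1) + 3 * c * (real r * (real r - 1))"
      by (subst triangle_weight_perturbed[OF w p])
        (simp_all only: 1 2, simp add: power2_eq_square power3_eq_cube)
    also have "\<dots> = (real r * (real r - 1) / (real r + 1)\<^sup>2
      - 3 * (real r - 1) / (real r + 1) * (real r / (real r + 1) - \<rho>)) * real (card blocks) ^ 2"
      unfolding card_blocks c_def using r r1
      by (simp add: divide_simps power2_eq_square power3_eq_cube) (simp add: algebra_simps)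
    finally show "triangle_weight (1 + c) p \<le> (real r * (real r - 1) / (real r + 1)\<^sup>2
      - 3 * (real r - 1) / (real r + 1) * (real r / (real r + 1) - \<rho>)) * real (card blocks) ^ 2" by simp
  qed
qed

text \<open>Both constructions are available on the whole interval, whose length is
  \<open>1 / (r * (r + 1))\<close>. The breakpoint is where the two linear bounds agree, with common
  value \<open>(r - 1)^2 / (r * (r + 1))\<close>.\<close>

theorem theorem1p4:
  fixes r :: nat and \<rho> :: real
  assumes "r \<ge> 1"
    and "\<rho> \<in> {(real r - 1) / real r .. real r / (real r + 1)}"
  shows
    "((real r - 1) / real r \<le> \<rho> \<and>
      \<rho> \<le> real r / (real r + 1) - 1 / (3 * real r * (real r + 1)) \<longrightarrow>
        tau \<rho> \<le> ereal ((real r - 1) * (real r - 2) / (real r)^2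
                   + 3 * (real r - 1) / real r * (\<rho> - (real r - 1) / real r)))
     \<and>
     (real r / (real r + 1) - 1 / (3 * real r * (real r + 1)) \<le> \<rho> \<and>
      \<rho> \<le> real r / (real r + 1) \<longrightarrow>
        tau \<rho> \<le> ereal (real r * (real r - 1) / (real r + 1)^2
                   - 3 * (real r - 1) / (real r + 1) * (real r / (real r + 1) - \<rho>)))"
proof (intro conjI impI; elim conjE)
  assume \<rho>: "(real r - 1) / real r \<le> \<rho>"
    "\<rho> \<le> real r / (real r + 1) - 1 / (3 * real r * (real r + 1))"
  \<comment> \<open>The excess over \<open>(r - 1) / r\<close> is at most the length of the
    interval, hence at most \<open>1 / (2 * r)\<close>, the capacity of the first
    construction.\<close>
  have "real r / (real r + 1) = (real r - 1) / real r + 1 / (real r * (real r + 1))"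
    using assms(1) by (simp add: divide_simps) algebra
  moreover have "1 / (real r * (real r + 1)) \<le> 1 / (2 * real r)"
    using assms(1) by (intro divide_left_mono) auto
  moreover have "0 \<le> 1 / (3 * real r * (real r + 1))" by simp
  ultimately have "real r / (real r + 1) - 1 / (3 * real r * (real r + 1))
    \<le> (real r - 1) / real r + 1 / (2 * real r)" by linarith
  with \<rho> show "tau \<rho> \<le> ereal ((real r - 1) * (real r - 2) / (real r)^2
    + 3 * (real r - 1) / real r * (\<rho> - (real r - 1) / real r))"
    by (intro tau_le_add_bipartite assms(1)) linarith+
next
  assume \<rho>: "real r / (real r + 1) - 1 / (3 * real r * (real r + 1)) \<le> \<rho>"
    "\<rho> \<le> real r / (real r + 1)"
  have "1 / (3 * real r * (real r + 1)) \<le> 1 / (real r * (real r + 1))"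
    using assms(1) by (intro divide_left_mono) auto
  moreover have "0 \<le> (real r - 1) / real r" using assms(1) by simp
  moreover have "(real r - 1) / real r \<le> \<rho>" using assms(2) by simp
  ultimately show "tau \<rho> \<le> ereal (real r * (real r - 1) / (real r + 1)^2
    - 3 * (real r - 1) / (real r + 1) * (real r / (real r + 1) - \<rho>))"
    using \<rho> by (intro tau_le_remove_bipartite assms(1)) linarith+
qed

end
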